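(* Let $A(z)$ be an entire function of order $\rho(A)=\rho\in[1,\infty)$. Suppose that there exist two zeros $\alpha,\beta\in\mathbb{R}$ of the indicator function $h_A$ such that $0<\beta-\alpha\le\pi/\rho$ and $h_A(\theta)<0$ for all $\theta\in(\alpha,\beta)$. Then, for any $\varepsilon>0$, every nontrivial solution $f$ of $f''+A(z)f=0$ has at most finitely many zeros in the sector $\alpha+\varepsilon<\arg(z)<\beta-\varepsilon$. (The number of zeros may depend on $\varepsilon$.)
   Context: The Phragmén–Lindelöf indicator of an entire function $A$ of order $\rho>0$ is $h_A(\theta)=\limsup_{r\to\infty}r^{-\rho}\log|A(re^{i\theta})|$. *)

theory Defs
  imports "HOL-Complex_Analysis.Complex_Analysis"
begin

definition max_modulus :: "(complex \<Rightarrow> complex) \<Rightarrow> real \<Rightarrow> real" where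
  "max_modulus A r = (SUP z\<in>sphere 0 r. norm (A z))"

(* log^+, so that the iterated logarithm below is meaningful for every entire function
   (constants included); for nonconstant A it agrees eventually with log. *)
definition ln_pos :: "real \<Rightarrow> real" where
  "ln_pos x = ln (max 1 x)"

definition entire_order :: "(complex \<Rightarrow> complex) \<Rightarrow> ereal" where
  "entire_order A = Limsup at_top (\<lambda>r. ereal (ln_pos (ln_pos (max_modulus A r)) / ln r))"

(* Logarithm with log 0 = -\<infinity>: the real ln has ln 0 = 0, which would give a wrong value
   of the indicator on rays carrying zeros of A. *)
definition ln_norm :: "complex \<Rightarrow> ereal" where
  "ln_norm w = (if w = 0 then -\<infinity> else ereal (ln (norm w)))"

(* \<rho> is meant to be the order of A; the value is extended real, since it can be
   \<infinity> (A of maximal type) or -\<infinity>. *)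
definition pl_indicator :: "real \<Rightarrow> (complex \<Rightarrow> complex) \<Rightarrow> real \<Rightarrow> ereal" where
  "pl_indicator \<rho> A \<theta> =
     Limsup at_top (\<lambda>r::real. ereal (r powr (-\<rho>)) * ln_norm (A (rcis r \<theta>)))"

(* Points having some argument in (a, b): a and b are arbitrary reals, so the principal
   value Arg cannot be used. *)
definition sector :: "real \<Rightarrow> real \<Rightarrow> complex set" where
  "sector a b = {rcis r \<theta> | r \<theta>. 0 < r \<and> a < \<theta> \<and> \<theta> < b}"

end

theory Submission
  imports Defs "HOL-Real_Asymp.Real_Asymp"
begin

text \<open>In the coordinate \<open>z = e\<^bsup>i m\<^esup> e\<^bsup>\<zeta>\<^esup>\<close>, with \<open>m\<close> the direction of the bisector, the
  sector becomes a horizontal strip and all functions involved are entire. The indicator is negative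
  on the two edges of the slightly smaller strip, whose width is less than \<open>\<pi> / \<rho>\<close>, so
  Phragmen--Lindelof applied to \<open>z\<^sup>3 A(z)\<close> shows that \<open>z\<^sup>2 A(z)\<close> tends to 0 in the
  sector. The function \<open>G(\<zeta>) = e\<^bsup>-\<zeta>/2\<^esup> f(z)\<close> satisfies \<open>G'' = (1/4 - z\<^sup>2 A(z)) G\<close>, and a
  Sturm comparison along the segment joining two of its zeros shows that \<open>f\<close> has at most one zero
  of large modulus in the sector.\<close>

section \<open>Sturm comparison along a segment\<close>

text \<open>The pair \<open>(u, w)\<close> is the real and imaginary part of a solution of \<open>g'' = (c + i d) g\<close>. The
  second derivative of \<open>\<bar>g\<bar>\<^sup>2 / cos\<^sup>2(k t + m)\<close> is positive at each critical point where
  \<open>g \<noteq> 0\<close>, so this quotient has no positive interior maximum.\<close>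

lemma sturm_comparison_complex:
  fixes u w u' w' c d :: "real \<Rightarrow> real" and k m a b :: real
  assumes du: "\<And>t. (u has_real_derivative u' t) (at t)"
    and dw: "\<And>t. (w has_real_derivative w' t) (at t)"
    and du': "\<And>t. (u' has_real_derivative (c t * u t - d t * w t)) (at t)"
    and dw': "\<And>t. (w' has_real_derivative (d t * u t + c t * w t)) (at t)"
    and cpos: "\<And>t. t \<in> {a..b} \<Longrightarrow> c t + k\<^sup>2 > 0"
    and phi: "\<And>t. t \<in> {a..b} \<Longrightarrow> cos (k * t + m) > 0"
    and zeros: "u a = 0" "w a = 0" "u b = 0" "w b = 0"
    and t: "t \<in> {a..b}"
  shows "u t = 0 \<and> w t = 0"
proof (rule ccontr)
  assume nz: "\<not> (u t = 0 \<and> w t = 0)"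
  define p where "p t = (u t)\<^sup>2 + (w t)\<^sup>2" for t
  define p1 where "p1 t = 2 * (u t * u' t + w t * w' t)" for t
  define p2 where "p2 t = 2 * ((u' t)\<^sup>2 + (w' t)\<^sup>2 + c t * p t)" for t
  define \<phi> where "\<phi> t = cos (k * t + m)" for t
  define \<psi> where "\<psi> t = - k * sin (k * t + m)" for t
  \<comment> \<open>\<open>N' = W / \<phi>^3\<close>, so \<open>W\<close> carries the sign of the
    derivative of the quotient wherever \<open>\<phi>\<close> is positive.\<close>
  define W where "W t = p1 t * \<phi> t - 2 * p t * \<psi> t" for t
  define N where "N t = p t / (\<phi> t)\<^sup>2" for t
  have dp: "(p has_real_derivative p1 s) (at s)" for s
    unfolding p_def p1_def by (auto intro!: derivative_eq_intros du dw)
  have dp1: "(p1 has_real_derivative p2 s) (at s)" for s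
    unfolding p1_def p2_def p_def
    by (auto intro!: derivative_eq_intros du dw du' dw' simp: power2_eq_square algebra_simps)
  have dphi: "(\<phi> has_real_derivative \<psi> s) (at s)" for s
    unfolding \<phi>_def \<psi>_def by (auto intro!: derivative_eq_intros)
  have dpsi: "(\<psi> has_real_derivative - k\<^sup>2 * \<phi> s) (at s)" for s
    unfolding \<phi>_def \<psi>_def by (auto intro!: derivative_eq_intros simp: power2_eq_square)
  have dW: "(W has_real_derivative p2 s * \<phi> s - p1 s * \<psi> s + 2 * k\<^sup>2 * p s * \<phi> s) (at s)" for s
    unfolding W_def by (auto intro!: derivative_eq_intros dp dp1 dphi dpsi simp: algebra_simps)
  have dN: "(N has_real_derivative W s / (\<phi> s) ^ 3) (at s)" if "\<phi> s > 0" for s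
    unfolding N_def W_def using that
    by (auto intro!: derivative_eq_intros dp dphi simp: field_simps power2_eq_square power3_eq_cube)
  have phi': "\<phi> s > 0" if "s \<in> {a..b}" for s
    using phi[OF that] by (simp add: \<phi>_def)
  have "continuous_on {a..b} N"
    by (intro continuous_at_imp_continuous_on ballI DERIV_isCont[OF dN] phi')
  then obtain s where s: "s \<in> {a..b}" and smax: "\<And>x. x \<in> {a..b} \<Longrightarrow> N x \<le> N s"
    using continuous_attains_sup[of "{a..b}" N] t by (metis compact_Icc empty_iff)
  have "p t > 0" using nz unfolding p_def by (simp add: sum_power2_gt_zero_iff)
  then have "N t > 0" using phi'[OF t] by (simp add: N_def)
  then have Ns: "N s > 0" using smax[OF t] by linarith
  then have ps: "p s > 0" using phi'[OF s] by (simp add: N_def zero_less_divide_iff)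
  have "N a = 0" "N b = 0" using zeros by (simp_all add: N_def p_def)
  then have sab: "a < s" "s < b" using s Ns by (force simp: less_le)+
  have Ws: "W s = 0"
  proof -
    have "W s / (\<phi> s) ^ 3 = 0"
    proof (rule DERIV_local_max[OF dN[OF phi'[OF s]], of "min (s - a) (b - s)"])
      show "\<forall>y. \<bar>s - y\<bar> < min (s - a) (b - s) \<longrightarrow> N y \<le> N s"
        using smax by (auto simp: abs_less_iff)
    qed (use sab in auto)
    then show ?thesis using phi'[OF s] by simp
  qed
  have "p1 s * \<phi> s = 2 * p s * \<psi> s" using Ws by (simp add: W_def)
  \<comment> \<open>Cauchy--Schwarz; by Lagrange's identity the defect is a square.\<close>
  have cs: "(p1 s)\<^sup>2 \<le> 4 * p s * ((u' s)\<^sup>2 + (w' s)\<^sup>2)"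
  proof -
    have "4 * p s * ((u' s)\<^sup>2 + (w' s)\<^sup>2) - (p1 s)\<^sup>2 = 4 * (u s * w' s - w s * u' s)\<^sup>2"
      unfolding p_def p1_def by (simp add: power2_eq_square algebra_simps)
    then show ?thesis by (smt (verit) zero_le_power2)
  qed
  \<comment> \<open>Multiplying \<open>W'\<close> by the positive factor \<open>2 p \<phi>\<close>
    allows \<open>p1^2 \<phi>^2\<close> to be added and subtracted. The cross term then contains
    \<open>W s = 0\<close>; of the rest, one term is nonnegative by Cauchy--Schwarz and the other
    positive by \<open>c + k^2 > 0\<close>.\<close>
  have "2 * p s * \<phi> s * (p2 s * \<phi> s - p1 s * \<psi> s + 2 * k\<^sup>2 * p s * \<phi> s)
        = (4 * p s * ((u' s)\<^sup>2 + (w' s)\<^sup>2) - (p1 s)\<^sup>2) * (\<phi> s)\<^sup>2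
          + p1 s * \<phi> s * (p1 s * \<phi> s - 2 * p s * \<psi> s) + 4 * (c s + k\<^sup>2) * (p s)\<^sup>2 * (\<phi> s)\<^sup>2"
    unfolding p2_def by (simp add: power2_eq_square algebra_simps)
  also have "\<dots> = (4 * p s * ((u' s)\<^sup>2 + (w' s)\<^sup>2) - (p1 s)\<^sup>2) * (\<phi> s)\<^sup>2
          + 4 * (c s + k\<^sup>2) * (p s)\<^sup>2 * (\<phi> s)\<^sup>2"
    using Ws by (simp add: W_def)
  also have "\<dots> > 0"
    using cs cpos[OF s] ps phi'[OF s]
    by (intro add_nonneg_pos[OF mult_nonneg_nonneg mult_pos_pos[OF mult_pos_pos[OF mult_pos_pos]]]) auto
  finally have "p2 s * \<phi> s - p1 s * \<psi> s + 2 * k\<^sup>2 * p s * \<phi> s > 0"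
    using ps phi'[OF s] by (auto intro: zero_less_mult_pos[of "2 * p s * \<phi> s"])
  \<comment> \<open>\<open>W\<close> vanishes at \<open>s\<close> with positive derivative, hence is
    positive just to the right of \<open>s\<close>, and \<open>N\<close> would increase strictly
    past its maximum.\<close>
  from DERIV_pos_inc_right[OF dW this] obtain e
    where e: "e > 0" "\<And>h. 0 < h \<Longrightarrow> h < e \<Longrightarrow> W (s + h) > 0" using Ws by auto
  define x where "x = s + min (e / 2) (b - s)"
  have x: "s < x" "x \<le> b" "x < s + e" using e(1) sab by (auto simp: x_def)
  have "N s < N x"
  proof (rule DERIV_pos_imp_increasing_open[OF x(1)])
    fix y assume y: "s < y" "y < x"
    then have "W y > 0" using e(2)[of "y - s"] x by auto
    moreover have "\<phi> y > 0" using phi' y x sab by auto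
    ultimately show "\<exists>l. (N has_real_derivative l) (at y) \<and> l > 0"
      using dN[of y] by (intro exI[of _ "W y / \<phi> y ^ 3"]) auto
  next
    show "continuous_on {s..x} N"
      by (intro continuous_at_imp_continuous_on ballI DERIV_isCont[OF dN] phi') (use x sab in auto)
  qed
  then show False using smax[of x] x sab by auto
qed

text \<open>With \<open>v = b - a\<close>, the restriction of \<open>G\<close> to the segment solves
  \<open>g'' = v^2 q g\<close>, and \<open>q\<close> being within 1/4 of 1/4 forces
  \<open>Re (v^2 q) > - (Im v)^2 / 2\<close>. Oscillation can thus come only from vertical
  displacement, and a strip of width \<open>pi\<close> is too narrow for it to produce a second
  zero.\<close>

lemma segment_zeros_imp_zero:
  fixes G G' q :: "complex \<Rightarrow> complex"
  assumes G: "\<And>z. (G has_field_derivative G' z) (at z)"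
    and G': "\<And>z. (G' has_field_derivative q z * G z) (at z)"
    and zeros: "G a = 0" "G b = 0" and ab: "a \<noteq> b"
    and strip: "\<bar>Im a\<bar> \<le> pi / 2" "\<bar>Im b\<bar> \<le> pi / 2"
    and q: "\<And>z. z \<in> closed_segment a b \<Longrightarrow> norm (q z - 1/4) < 1/4"
    and z: "z \<in> closed_segment a b"
  shows "G z = 0"
proof -
  define v where "v = b - a"
  define l where "l t = a + of_real t * v" for t :: real
  have l: "(l has_vector_derivative v) (at t)" for t
    unfolding l_def by (auto intro!: derivative_eq_intros)
  have l_seg: "l t \<in> closed_segment a b" if "t \<in> {0..1}" for t
    using that unfolding l_def v_def closed_segment_def
    by (auto intro!: exI[of _ t] simp: scaleR_conv_of_real algebra_simps)
  obtain t where t: "t \<in> {0..1}" "z = l t"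
    using z unfolding l_def v_def closed_segment_def
    by (auto simp: scaleR_conv_of_real algebra_simps)
  have dG: "((\<lambda>t. G (l t)) has_vector_derivative v * G' (l t)) (at t)" for t
    using field_vector_diff_chain_at[OF l G] by (simp add: o_def)
  have dG': "((\<lambda>t. v * G' (l t)) has_vector_derivative v * (v * (q (l t) * G (l t)))) (at t)" for t
    using field_vector_diff_chain_at[OF l G']
    by (intro has_vector_derivative_mult_right) (simp add: o_def)
  note Re = bounded_linear.has_vector_derivative[OF bounded_linear_Re]
    and Im = bounded_linear.has_vector_derivative[OF bounded_linear_Im]
  \<comment> \<open>The factor 3/4 works because it lies strictly between 1/2, which compensates for
    \<open>Re (v\<^sup>2) / 4 = - (Im v)\<^sup>2 / 4\<close> on vertical segments, and 1, which keeps the cosine positive.\<close>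
  have "Re (G (l t)) = 0 \<and> Im (G (l t)) = 0"
  proof (rule sturm_comparison_complex[where u = "\<lambda>t. Re (G (l t))" and w = "\<lambda>t. Im (G (l t))" and a = 0 and b = 1 and k = "3/4 * Im v"
        and m = "3/4 * Im a" and c = "\<lambda>t. Re (v\<^sup>2 * q (l t))" and d = "\<lambda>t. Im (v\<^sup>2 * q (l t))"
        and u' = "\<lambda>t. Re (v * G' (l t))" and w' = "\<lambda>t. Im (v * G' (l t))"])
    fix t
    show "((\<lambda>t. Re (G (l t))) has_real_derivative Re (v * G' (l t))) (at t)"
      "((\<lambda>t. Im (G (l t))) has_real_derivative Im (v * G' (l t))) (at t)"
      unfolding has_real_derivative_iff_has_vector_derivative by (fact Re[OF dG] Im[OF dG])+
    have "Re (v\<^sup>2 * q (l t)) * Re (G (l t)) - Im (v\<^sup>2 * q (l t)) * Im (G (l t))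
          = Re (v * (v * (q (l t) * G (l t))))"
      by (simp add: power2_eq_square flip: mult.assoc times_complex.sel)
    then show "((\<lambda>t. Re (v * G' (l t))) has_real_derivative
        Re (v\<^sup>2 * q (l t)) * Re (G (l t)) - Im (v\<^sup>2 * q (l t)) * Im (G (l t))) (at t)"
      unfolding has_real_derivative_iff_has_vector_derivative by (simp only: Re[OF dG'])
    have "Im (v\<^sup>2 * q (l t)) * Re (G (l t)) + Re (v\<^sup>2 * q (l t)) * Im (G (l t))
          = Im (v * (v * (q (l t) * G (l t))))"
      by (simp add: power2_eq_square algebra_simps)
    then show "((\<lambda>t. Im (v * G' (l t))) has_real_derivative
        Im (v\<^sup>2 * q (l t)) * Re (G (l t)) + Re (v\<^sup>2 * q (l t)) * Im (G (l t))) (at t)"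
      unfolding has_real_derivative_iff_has_vector_derivative by (simp only: Im[OF dG'])
  next
    fix t :: real assume t: "t \<in> {0..1}"
    have "v\<^sup>2 * q (l t) = v\<^sup>2 / 4 + v\<^sup>2 * (q (l t) - 1/4)" by (simp add: algebra_simps)
    then have "Re (v\<^sup>2 * q (l t)) = Re (v\<^sup>2) / 4 + Re (v\<^sup>2 * (q (l t) - 1/4))" by simp
    moreover have "\<bar>Re (v\<^sup>2 * (q (l t) - 1/4))\<bar> \<le> (norm v)\<^sup>2 * norm (q (l t) - 1/4)"
      using abs_Re_le_cmod[of "v\<^sup>2 * (q (l t) - 1/4)"] by (simp add: norm_mult norm_power)
    moreover have "(norm v)\<^sup>2 * norm (q (l t) - 1/4) < (norm v)\<^sup>2 * (1/4)"
      using q[OF l_seg[OF t]] ab by (intro mult_strict_left_mono) (auto simp: v_def)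
    moreover have "(norm v)\<^sup>2 = (Re v)\<^sup>2 + (Im v)\<^sup>2" by (rule cmod_power2)
    moreover have "Re (v\<^sup>2) = (Re v)\<^sup>2 - (Im v)\<^sup>2" by (simp add: power2_eq_square)
    moreover have "(3/4 * Im v)\<^sup>2 = 9/16 * (Im v)\<^sup>2" by (simp add: power2_eq_square)
    ultimately show "Re (v\<^sup>2 * q (l t)) + (3/4 * Im v)\<^sup>2 > 0"
      using zero_le_power2[of "Re v"] zero_le_power2[of "Im v"] by linarith
    have "\<bar>Im (l t)\<bar> \<le> pi / 2"
    proof -
      let ?S = "{z. Im z \<le> pi / 2} \<inter> {z. Im z \<ge> - (pi / 2)}"
      have "convex ?S"
        by (intro convex_Int convex_halfspace_Im_le convex_halfspace_Im_ge)
      moreover have "a \<in> ?S" "b \<in> ?S" using strip by (auto simp: abs_le_iff)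
      ultimately have "closed_segment a b \<subseteq> ?S" by (intro closed_segment_subset)
      then have "l t \<in> ?S" using l_seg[OF t] by (rule subsetD)
      then show ?thesis by auto
    qed
    then have "\<bar>3/4 * Im (l t)\<bar> < pi / 2" using pi_gt_zero by linarith
    then have "cos (3/4 * Im (l t)) > 0" by (intro cos_gt_zero_pi) linarith+
    moreover have "3/4 * Im v * t + 3/4 * Im a = 3/4 * Im (l t)" by (simp add: l_def)
    ultimately show "cos (3/4 * Im v * t + 3/4 * Im a) > 0" by (simp only:)
  qed (use zeros t in \<open>auto simp: l_def v_def\<close>)
  then show ?thesis unfolding t(2) by (simp add: complex_eq_iff)
qed

section \<open>Phragmen--Lindelof in a half-strip\<close>

text \<open>The hypothesis \<open>small\<close> is where the growth restriction enters: it makes the damping factor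
  \<open>exp (- \<eta> e\<^bsup>\<sigma> z\<^esup>)\<close>, whose modulus is at most \<open>exp (- \<eta> cos (\<sigma> w) e\<^bsup>\<sigma> Re z\<^esup>)\<close> in the strip,
  beat \<open>H\<close> on the right edge of a long rectangle.\<close>

lemma phragmen_lindelof_half_strip:
  fixes H :: "complex \<Rightarrow> complex" and \<sigma> w X M :: real and g :: "real \<Rightarrow> real"
  assumes holo: "H holomorphic_on UNIV"
    and \<sigma>: "\<sigma> > 0" "\<sigma> * w < pi / 2" and w: "w > 0" and M: "M > 0"
    and growth: "\<And>z. Re z \<ge> X \<Longrightarrow> \<bar>Im z\<bar> \<le> w \<Longrightarrow> norm (H z) \<le> g (Re z)"
    and small: "\<And>\<eta>. \<eta> > 0 \<Longrightarrow> ((\<lambda>x. g x * exp (- \<eta> * exp (\<sigma> * x))) \<longlongrightarrow> 0) at_top"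
    and edges: "\<And>z. Re z \<ge> X \<Longrightarrow> \<bar>Im z\<bar> = w \<Longrightarrow> norm (H z) \<le> M"
    and left: "\<And>z. Re z = X \<Longrightarrow> \<bar>Im z\<bar> \<le> w \<Longrightarrow> norm (H z) \<le> M"
    and z: "Re z \<ge> X" "\<bar>Im z\<bar> \<le> w"
  shows "norm (H z) \<le> M"
proof -
  define c where "c = cos (\<sigma> * w)"
  have c: "c > 0" unfolding c_def using \<sigma> w by (intro cos_gt_zero_pi) (auto intro: less_trans[of _ 0])
  have \<sigma>w: "\<sigma> * w \<le> pi" using \<sigma>(2) pi_gt_zero by linarith
  define E where "E \<eta> z = H z * exp (- of_real \<eta> * exp (of_real \<sigma> * z))" for \<eta> z
  have E_le: "norm (E \<eta> z) \<le> norm (H z) * exp (- \<eta> * c * exp (\<sigma> * Re z))"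
    if "\<eta> > 0" "\<bar>Im z\<bar> \<le> w" for \<eta> z
  proof -
    have "cos (\<sigma> * w) \<le> cos (\<bar>\<sigma> * Im z\<bar>)"
      using that \<sigma> w \<sigma>w by (intro cos_monotone_0_pi_le) (auto simp: abs_mult)
    then have "c * (\<eta> * exp (\<sigma> * Re z)) \<le> cos (\<sigma> * Im z) * (\<eta> * exp (\<sigma> * Re z))"
      unfolding c_def using that by (intro mult_right_mono) auto
    then show ?thesis
      unfolding E_def norm_mult norm_exp_eq_Re
      by (intro mult_left_mono) (auto simp: Re_exp algebra_simps)
  qed
  \<comment> \<open>Maximum principle on a rectangle whose right edge \<open>Re y = R\<close> lies
    beyond \<open>z\<close> and so far out that the damped majorant is below \<open>M\<close>
    there.\<close>
  have bound: "norm (E \<eta> z) \<le> M" if \<eta>: "\<eta> > 0" for \<eta>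
  proof -
    have "((\<lambda>x. g x * exp (- (\<eta> * c) * exp (\<sigma> * x))) \<longlongrightarrow> 0) at_top"
      using small[of "\<eta> * c"] \<eta> c by simp
    then have "eventually (\<lambda>x. g x * exp (- (\<eta> * c) * exp (\<sigma> * x)) < M) at_top"
      using M by (rule order_tendstoD)
    then have "eventually (\<lambda>x. g x * exp (- (\<eta> * c) * exp (\<sigma> * x)) < M \<and> x > Re z) at_top"
      by (intro eventually_conj eventually_gt_at_top)
    then obtain R where R: "g R * exp (- (\<eta> * c) * exp (\<sigma> * R)) < M" "R > Re z"
      using eventually_happens'[OF trivial_limit_at_top_linorder] by blast
    have E_le_H: "norm (E \<eta> y) \<le> norm (H y)" if "\<bar>Im y\<bar> \<le> w" for y
    proof -
      have "norm (H y) * exp (- \<eta> * c * exp (\<sigma> * Re y)) \<le> norm (H y) * 1"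
        using \<eta> c by (intro mult_left_mono) auto
      then show ?thesis using E_le[OF \<eta> that] by simp
    qed
    define Q where "Q = cbox (Complex X (-w)) (Complex R w)"
    have holE: "E \<eta> holomorphic_on S" for S
      unfolding E_def by (intro holomorphic_intros holomorphic_on_subset[OF holo]) auto
    show ?thesis
    proof (rule maximum_modulus_frontier[of "E \<eta>" Q])
      show "z \<in> Q" using z R by (auto simp: Q_def in_cbox_complex_iff)
      show "E \<eta> holomorphic_on interior Q" "continuous_on (closure Q) (E \<eta>)"
        by (intro holE holomorphic_on_imp_continuous_on)+
      show "bounded Q" by (simp add: Q_def)
    next
      fix y assume "y \<in> frontier Q"
      then have y: "Re y \<ge> X" "Re y \<le> R" "\<bar>Im y\<bar> \<le> w"
        and y': "Re y = X \<or> Re y = R \<or> \<bar>Im y\<bar> = w"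
        unfolding Q_def frontier_cbox
        by (auto simp: in_cbox_complex_iff in_box_complex_iff)
      consider "Re y = X \<or> \<bar>Im y\<bar> = w" | "Re y = R" using y' by blast
      then show "norm (E \<eta> y) \<le> M"
      proof cases
        case 1
        then show ?thesis using E_le_H[OF y(3)] left[of y] edges[of y] y by fastforce
      next
        case 2
        have "norm (H y) * exp (- \<eta> * c * exp (\<sigma> * Re y)) \<le> g R * exp (- \<eta> * c * exp (\<sigma> * R))"
          using growth[OF y(1,3)] 2 by (simp add: mult_right_mono)
        then show ?thesis using E_le[OF \<eta> y(3)] R by simp
      qed
    qed
  qed
  \<comment> \<open>The bound \<open>M\<close> does not depend on \<open>\<eta>\<close>, so letting
    \<open>\<eta>\<close> tend to 0 at the fixed point \<open>z\<close> removes the damping.\<close>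
  have "((\<lambda>\<eta>. norm (E \<eta> z)) \<longlongrightarrow> norm (E 0 z)) (at_right 0)"
    unfolding E_def by (intro tendsto_intros)
  moreover have "eventually (\<lambda>\<eta>. norm (E \<eta> z) \<le> M) (at_right (0::real))"
    using bound by (auto intro!: eventually_at_rightI[of 0 1])
  ultimately have "norm (E 0 z) \<le> M"
    by (rule tendsto_upperbound) simp
  then show ?thesis by (simp add: E_def)
qed

section \<open>Growth from the order, decay from the indicator\<close>

text \<open>A limsup strictly below \<open>\<sigma>\<close> bounds the quotient itself for large
  \<open>r\<close>. The truncations in \<open>ln_pos\<close> only enlarge what they replace, so
  exponentiating twice still gives an upper bound for the maximum modulus.\<close>

lemma entire_order_bound:
  assumes A: "A holomorphic_on UNIV" and ord: "entire_order A < ereal \<sigma>"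
  shows "eventually (\<lambda>r. \<forall>z. norm z = r \<longrightarrow> norm (A z) \<le> exp (r powr \<sigma>)) at_top"
proof -
  have "eventually (\<lambda>r. ereal (ln_pos (ln_pos (max_modulus A r)) / ln r) < ereal \<sigma>) at_top"
    using ord unfolding entire_order_def by (rule Limsup_lessD)
  then show ?thesis using eventually_gt_at_top[of 1]
  proof eventually_elim
    case (elim r)
    let ?m = "max_modulus A r"
    show ?case
    proof (intro allI impI)
      fix z :: complex assume z: "norm z = r"
      have "compact ((\<lambda>z. norm (A z)) ` sphere 0 r)"
        by (intro compact_continuous_image continuous_intros holomorphic_on_imp_continuous_on
            holomorphic_on_subset[OF A]) auto
      then have "bdd_above ((\<lambda>z. norm (A z)) ` sphere 0 r)"
        by (intro bounded_imp_bdd_above compact_imp_bounded)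
      then have "norm (A z) \<le> ?m"
        unfolding max_modulus_def using z by (intro cSUP_upper) auto
      also have "?m \<le> exp (ln (max 1 ?m))" by simp
      also have "ln (max 1 ?m) \<le> max 1 (ln_pos ?m)" by (simp add: ln_pos_def)
      also have "\<dots> = exp (ln (max 1 (ln_pos ?m)))" by simp
      also have "ln (max 1 (ln_pos ?m)) \<le> \<sigma> * ln r"
        using elim by (simp add: ln_pos_def field_simps)
      also have "exp (\<sigma> * ln r) = r powr \<sigma>" using elim by (simp add: powr_def)
      finally show "norm (A z) \<le> exp (r powr \<sigma>)" by simp
    qed
  qed
qed

text \<open>A negative indicator gives \<open>norm (A z) \<le> exp (c r^\<rho>)\<close> on the ray
  for some \<open>c < 0\<close>. As \<open>\<rho> \<ge> 1\<close>, this is at most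
  \<open>exp (c r)\<close>, which beats every power of \<open>r\<close>.\<close>

lemma pl_indicator_neg_decay:
  assumes "pl_indicator \<rho> A \<theta> < 0" and \<rho>: "\<rho> \<ge> 1"
  shows "eventually (\<lambda>r. r ^ n * norm (A (rcis r \<theta>)) \<le> 1) at_top"
proof -
  obtain c where c: "pl_indicator \<rho> A \<theta> < ereal c" "c < 0"
    using assms(1) ereal_dense2 by (metis ereal_less(2) zero_ereal_def less_ereal.simps(1))
  have "eventually (\<lambda>r. ereal (r powr (-\<rho>)) * ln_norm (A (rcis r \<theta>)) < ereal c) at_top"
    using c(1) unfolding pl_indicator_def by (rule Limsup_lessD)
  moreover have "eventually (\<lambda>r::real. r ^ n * exp (c * r) < 1) at_top"
    using c(2) by real_asymp
  ultimately show ?thesis using eventually_gt_at_top[of 1]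
  proof eventually_elim
    case (elim r)
    show ?case
    proof (cases "A (rcis r \<theta>) = 0")
      case False
      have "r powr (-\<rho>) * ln (norm (A (rcis r \<theta>))) < c"
        using elim False by (simp add: ln_norm_def)
      then have "ln (norm (A (rcis r \<theta>))) < c * r powr \<rho>"
        using elim by (simp add: powr_minus field_simps)
      also have "c * r powr \<rho> \<le> c * r"
        using c(2) elim powr_mono[OF \<rho>, of r] by (intro mult_left_mono_neg) auto
      finally have "exp (ln (norm (A (rcis r \<theta>)))) \<le> exp (c * r)" by simp
      then have "norm (A (rcis r \<theta>)) \<le> exp (c * r)" using False by simp
      then have "r ^ n * norm (A (rcis r \<theta>)) \<le> r ^ n * exp (c * r)"
        using elim by (intro mult_left_mono) auto
      then show ?thesis using elim by linarith
    qed simp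
  qed
qed

text \<open>Decay on the two bounding rays spreads to the whole sector: its opening
  \<open>2 w\<close> is less than \<open>pi / \<rho>\<close>, so Phragmen--Lindelof applies to
  \<open>exp z ^ n * A (cis m * exp z)\<close> in the logarithmic coordinate.\<close>

lemma sector_decay:
  fixes A :: "complex \<Rightarrow> complex" and \<rho> m w :: real
  assumes A: "A holomorphic_on UNIV" and ord: "entire_order A = ereal \<rho>" and \<rho>: "\<rho> \<ge> 1"
    and w: "w > 0" "\<rho> * w < pi / 2"
    and neg: "pl_indicator \<rho> A (m - w) < 0" "pl_indicator \<rho> A (m + w) < 0"
  obtains M X where
    "\<And>z. Re z \<ge> X \<Longrightarrow> \<bar>Im z\<bar> \<le> w \<Longrightarrow> exp (Re z) ^ n * norm (A (cis m * exp z)) \<le> M"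
proof -
  \<comment> \<open>Two exponents are inserted above \<open>\<rho>\<close>: \<open>\<tau>\<close>
    bounds the growth of \<open>A\<close>, and the larger \<open>\<sigma>\<close> drives the damping
    factor, which must win against it; \<open>\<sigma> * w < pi / 2\<close> keeps the cosine
    positive.\<close>
  have "\<rho> < pi / 2 / w" using w by (simp add: field_simps)
  then obtain \<sigma> where \<sigma>: "\<rho> < \<sigma>" "\<sigma> < pi / 2 / w" using dense by blast
  obtain \<tau> where \<tau>: "\<rho> < \<tau>" "\<tau> < \<sigma>" using dense \<sigma>(1) by blast
  have "entire_order A < ereal \<tau>" using ord \<tau> by simp
  note ev = entire_order_bound[OF A this] pl_indicator_neg_decay[OF neg(1) \<rho>, of n]
    pl_indicator_neg_decay[OF neg(2) \<rho>, of n]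
  have "eventually (\<lambda>x. (\<forall>z. norm z = exp x \<longrightarrow> norm (A z) \<le> exp (exp x powr \<tau>)) \<and>
      exp x ^ n * norm (A (rcis (exp x) (m - w))) \<le> 1 \<and>
      exp x ^ n * norm (A (rcis (exp x) (m + w))) \<le> 1) (at_top :: real filter)"
    by (intro eventually_conj eventually_compose_filterlim[OF _ exp_at_top] ev)
  then obtain X where order: "\<And>z x. x \<ge> X \<Longrightarrow> norm z = exp x \<Longrightarrow> norm (A z) \<le> exp (exp (\<tau> * x))"
    and edge: "\<And>x. x \<ge> X \<Longrightarrow> exp x ^ n * norm (A (rcis (exp x) (m - w))) \<le> 1"
      "\<And>x. x \<ge> X \<Longrightarrow> exp x ^ n * norm (A (rcis (exp x) (m + w))) \<le> 1"
    unfolding eventually_at_top_linorder by (auto simp: powr_def)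
  define H where "H z = exp z ^ n * A (cis m * exp z)" for z
  have norm_H: "norm (H z) = exp (Re z) ^ n * norm (A (cis m * exp z))" for z
    by (simp add: H_def norm_mult norm_power)
  have H: "H holomorphic_on S" for S
    unfolding H_def
    by (intro holomorphic_intros holomorphic_on_compose_gen[OF _ A, unfolded o_def]) auto
  \<comment> \<open>The left edge of the half-strip, a degenerate box. In the final bound
    \<open>max 1 B\<close>, the 1 serves the horizontal edges and \<open>B\<close> this compact
    edge.\<close>
  define K where "K = cbox (Complex X (-w)) (Complex X w)"
  have "bounded (H ` K)"
    unfolding K_def
    by (intro compact_imp_bounded compact_continuous_image holomorphic_on_imp_continuous_on H compact_cbox)
  then obtain B where B: "\<And>z. z \<in> K \<Longrightarrow> norm (H z) \<le> B"
    by (auto simp: bounded_iff)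
  have "norm (H z) \<le> max 1 B" if z: "Re z \<ge> X" "\<bar>Im z\<bar> \<le> w" for z
  proof (rule phragmen_lindelof_half_strip[where H = H and z = z and M = "max 1 B"
        and \<sigma> = \<sigma> and w = w and X = X and g = "\<lambda>x. exp x ^ n * exp (exp (\<tau> * x))"])
    show "\<sigma> > 0" "\<sigma> * w < pi / 2" using \<sigma> \<rho> w by (auto simp: field_simps)
    show "norm (H z) \<le> exp (Re z) ^ n * exp (exp (\<tau> * Re z))" if "Re z \<ge> X" for z
      unfolding norm_H using order[OF that, of "cis m * exp z"]
      by (intro mult_left_mono) (auto simp: norm_mult)
    show "((\<lambda>x. exp x ^ n * exp (exp (\<tau> * x)) * exp (- \<eta> * exp (\<sigma> * x))) \<longlongrightarrow> 0) at_top"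
      if "\<eta> > 0" for \<eta>
    proof -
      have "\<tau> > 0" "\<sigma> > 0" using \<tau> \<rho> by linarith+
      then show ?thesis using that \<tau>(2) by real_asymp
    qed
    show "norm (H z) \<le> max 1 B" if z: "Re z \<ge> X" "\<bar>Im z\<bar> = w" for z
    proof -
      have "Im z = - w \<or> Im z = w" using z by linarith
      moreover have "cis m * exp z = rcis (exp (Re z)) (m + Im z)"
        by (simp add: rcis_def exp_eq_polar mult_ac flip: cis_mult)
      ultimately show ?thesis using edge[OF z(1)] norm_H[of z] by auto
    qed
    show "norm (H z) \<le> max 1 B" if "Re z = X" "\<bar>Im z\<bar> \<le> w" for z
    proof -
      have "z \<in> K" using that by (auto simp: K_def in_cbox_complex_iff)
      then show ?thesis using B[of z] by linarith
    qed
  qed (use H w z in auto)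
  then show ?thesis using norm_H by (intro that[of X "max 1 B"]) simp
qed

section \<open>Zeros of solutions far out in the sector\<close>

text \<open>Two distinct zeros would make the transformed solution vanish on the segment between
  them, which stays in the convex half-strip; by the identity theorem the solution would then be
  trivial.\<close>

lemma at_most_one_zero_half_strip:
  fixes A f :: "complex \<Rightarrow> complex" and c :: complex and X w :: real
  assumes f: "f holomorphic_on UNIV" and ode: "\<And>z. (deriv ^^ 2) f z + A z * f z = 0"
    and nz: "f z0 \<noteq> 0" and c: "c \<noteq> 0" and w: "w \<le> pi / 2"
    and small: "\<And>z. Re z \<ge> X \<Longrightarrow> \<bar>Im z\<bar> \<le> w \<Longrightarrow> norm ((c * exp z)\<^sup>2 * A (c * exp z)) < 1 / 4"
    and a: "Re a \<ge> X" "\<bar>Im a\<bar> \<le> w" "f (c * exp a) = 0"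
    and b: "Re b \<ge> X" "\<bar>Im b\<bar> \<le> w" "f (c * exp b) = 0"
  shows "a = b"
proof (rule ccontr)
  assume ab: "a \<noteq> b"
  \<comment> \<open>The substitution \<open>c * exp z\<close> creates a first-order term in the
    equation; the factor \<open>exp (- z / 2)\<close> removes it and leaves the constant
    1/4.\<close>
  define G where "G z = exp (- z / 2) * f (c * exp z)" for z
  define G' where "G' z = exp (- z / 2) * (c * exp z * deriv f (c * exp z) - f (c * exp z) / 2)" for z
  have df: "(f has_field_derivative deriv f z) (at z)" for z
    by (rule holomorphic_derivI[OF f]) auto
  have ddf: "(deriv f has_field_derivative - A z * f z) (at z)" for z
  proof -
    have "(deriv f has_field_derivative deriv (deriv f) z) (at z)"
      by (rule holomorphic_derivI[OF holomorphic_deriv[OF f]]) auto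
    then show ?thesis using ode[of z] by (simp add: numeral_2_eq_2 add_eq_0_iff)
  qed
  have dG: "(G has_field_derivative G' z) (at z)" for z
    unfolding G_def G'_def
    by (auto intro!: derivative_eq_intros DERIV_chain2[OF df] simp: algebra_simps)
  have dG': "(G' has_field_derivative (1 / 4 - (c * exp z)\<^sup>2 * A (c * exp z)) * G z) (at z)" for z
  proof -
    have e: "((\<lambda>z. c * exp z) has_field_derivative c * exp z) (at z)"
      by (auto intro!: derivative_eq_intros)
    have h: "((\<lambda>z. exp (- z / 2)) has_field_derivative - exp (- z / 2) / 2) (at z)"
      by (auto intro!: derivative_eq_intros)
    note D = DERIV_mult[OF h DERIV_diff[OF DERIV_mult[OF e DERIV_chain2[OF ddf e]]
          DERIV_cdivide[OF DERIV_chain2[OF df e], of 2]]]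
    show ?thesis
      unfolding G_def G'_def by (rule DERIV_cong[OF D]) (simp add: power2_eq_square ring_distribs)
  qed
  have "G z = 0" if z: "z \<in> closed_segment a b" for z
  proof (rule segment_zeros_imp_zero[OF dG dG' _ _ ab _ _ _ z])
    fix y assume y: "y \<in> closed_segment a b"
    let ?S = "{z. Re z \<ge> X} \<inter> {z. Im z \<le> w} \<inter> {z. Im z \<ge> - w}"
    have "convex ?S"
      by (intro convex_Int convex_halfspace_Re_ge convex_halfspace_Im_le convex_halfspace_Im_ge)
    then have "y \<in> ?S"
      using closed_segment_subset[of a ?S b] y a b by (auto simp: abs_le_iff)
    then have "Re y \<ge> X" "\<bar>Im y\<bar> \<le> w" by auto
    then show "norm (1 / 4 - (c * exp y)\<^sup>2 * A (c * exp y) - 1 / 4) < 1 / 4"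
      using small[of y] by simp
  qed (use a b w in \<open>auto simp: G_def\<close>)
  moreover have "a islimpt closed_segment a b"
    by (rule connected_imp_perfect) (use ab ends_in_segment in \<open>auto, metis singletonD\<close>)
  moreover have "G holomorphic_on UNIV"
    using dG by (auto simp: holomorphic_on_open)
  ultimately have "G z = 0" for z
    using analytic_continuation[of G UNIV "closed_segment a b" a z] by auto
  \<comment> \<open>The exponential misses only 0, so the origin needs a second use of the identity
    theorem.\<close>
  then have f0: "f z = 0" if "z \<noteq> 0" for z
    using that c exp_Ln[of "z / c"] by (simp add: G_def)
      (metis divide_eq_0_iff exp_Ln nonzero_mult_div_cancel_left times_divide_eq_right)
  have "(0 :: complex) islimpt - {0}"
    using islimpt_punctured[of "0 :: complex" UNIV] by (simp add: Compl_eq_Diff_UNIV islimpt_UNIV)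
  then have "f z0 = 0"
    by (rule analytic_continuation[OF f open_UNIV connected_UNIV subset_UNIV UNIV_I])
      (auto simp: f0)
  then show False using nz by simp
qed

section \<open>Finiteness of the zeros in the sector\<close>

theorem theorem12:
  fixes A :: "complex \<Rightarrow> complex" and \<rho> \<alpha> \<beta> :: real
  assumes "A holomorphic_on UNIV"
    and "entire_order A = ereal \<rho>"
    and "1 \<le> \<rho>"
    and "pl_indicator \<rho> A \<alpha> = 0"
    and "pl_indicator \<rho> A \<beta> = 0"
    and "0 < \<beta> - \<alpha>"
    and "\<beta> - \<alpha> \<le> pi / \<rho>"
    and "\<And>\<theta>. \<alpha> < \<theta> \<Longrightarrow> \<theta> < \<beta> \<Longrightarrow> pl_indicator \<rho> A \<theta> < 0"
  shows "\<forall>\<epsilon>>0. \<forall>f. f holomorphic_on UNIV \<longrightarrow>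
           (\<forall>z. (deriv ^^ 2) f z + A z * f z = 0) \<longrightarrow>
           (\<exists>z. f z \<noteq> 0) \<longrightarrow>
           finite {z \<in> sector (\<alpha> + \<epsilon>) (\<beta> - \<epsilon>). f z = 0}"
proof (intro allI impI)
  fix \<epsilon> :: real and f :: "complex \<Rightarrow> complex"
  assume \<epsilon>: "\<epsilon> > 0" and f: "f holomorphic_on UNIV"
    and ode: "\<forall>z. (deriv ^^ 2) f z + A z * f z = 0" and nz: "\<exists>z. f z \<noteq> 0"
  define m where "m = (\<alpha> + \<beta>) / 2"
  define w where "w = (\<beta> - \<alpha>) / 2 - \<epsilon>"
  have mw: "\<alpha> + \<epsilon> = m - w" "\<beta> - \<epsilon> = m + w" by (simp_all add: m_def w_def field_simps)
  show "finite {z \<in> sector (\<alpha> + \<epsilon>) (\<beta> - \<epsilon>). f z = 0}"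
  proof (cases "w > 0")
    case False
    then have "sector (\<alpha> + \<epsilon>) (\<beta> - \<epsilon>) = {}" unfolding mw sector_def by auto
    then show ?thesis by simp
  next
    case w: True
    have "\<rho> * (\<beta> - \<alpha>) \<le> pi" using assms(3,7) by (simp add: field_simps)
    moreover have "\<rho> * \<epsilon> > 0" using assms(3) \<epsilon> by simp
    \<comment> \<open>The loss of \<open>\<epsilon>\<close> on each side makes this strict even when
      \<open>\<beta> - \<alpha> = pi / \<rho>\<close>.\<close>
    ultimately have \<rho>w: "\<rho> * w < pi / 2" by (simp add: w_def algebra_simps)
    have "1 * w \<le> \<rho> * w" using assms(3) w by (intro mult_right_mono) auto
    then have w_pi: "w \<le> pi / 2" using \<rho>w by simp
    have neg: "pl_indicator \<rho> A (m - w) < 0" "pl_indicator \<rho> A (m + w) < 0"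
      using assms(8) \<epsilon> w by (auto simp: m_def w_def field_simps)
    \<comment> \<open>The third power is one more than the square in the transformed equation: the
      spare factor \<open>exp (Re z)\<close>, once above \<open>4 * M\<close>, pushes
      \<open>z^2 A(z)\<close> below 1/4.\<close>
    obtain M X where MX: "\<And>z. Re z \<ge> X \<Longrightarrow> \<bar>Im z\<bar> \<le> w \<Longrightarrow>
        exp (Re z) ^ 3 * norm (A (cis m * exp z)) \<le> M"
      using sector_decay[OF assms(1-3) w \<rho>w neg] by metis
    have "eventually (\<lambda>x. exp x > 4 * M) at_top"
      using exp_at_top by (simp add: filterlim_at_top_dense)
    then obtain Y where Y: "\<And>x. x \<ge> Y \<Longrightarrow> exp x > 4 * M"
      by (auto simp: eventually_at_top_linorder)
    define R where "R = exp (max X Y)"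
    have small: "norm ((cis m * exp z)\<^sup>2 * A (cis m * exp z)) < 1 / 4"
      if z: "Re z \<ge> max X Y" "\<bar>Im z\<bar> \<le> w" for z
    proof -
      have "exp (Re z) * norm ((cis m * exp z)\<^sup>2 * A (cis m * exp z))
            = exp (Re z) ^ 3 * norm (A (cis m * exp z))"
        by (simp add: norm_mult norm_power power2_eq_square power3_eq_cube)
      also have "\<dots> < exp (Re z) * (1 / 4)" using MX[of z] Y[of "Re z"] z by simp
      finally show ?thesis by (subst (asm) mult_less_cancel_left_pos) auto
    qed
    define Z where "Z = {z \<in> sector (\<alpha> + \<epsilon>) (\<beta> - \<epsilon>). f z = 0}"
    have at_most_one: "z1 = z2"
      if z12: "z1 \<in> Z" "z2 \<in> Z" "norm z1 > R" "norm z2 > R" for z1 z2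
    proof -
      \<comment> \<open>The logarithm is taken with imaginary part \<open>\<theta> - m\<close>, from
        the angle witnessing membership in the sector, so that it lands in the strip whatever the
        principal argument is.\<close>
      have log: "\<exists>a. Re a \<ge> max X Y \<and> \<bar>Im a\<bar> \<le> w \<and> z = cis m * exp a" if z: "z \<in> Z" "norm z > R" for z
      proof -
        obtain r \<theta> where r: "z = rcis r \<theta>" "r > 0" "m - w < \<theta>" "\<theta> < m + w"
          using z(1) unfolding Z_def sector_def mw by blast
        have "exp (max X Y) < r" using z(2) r by (simp add: R_def)
        then have "max X Y < ln r" using r by (metis exp_less_cancel_iff exp_ln)
        moreover have "z = cis m * exp (Complex (ln r) (\<theta> - m))"
          using r by (simp add: rcis_def exp_eq_polar cis_mult)
        ultimately show ?thesis using r by (intro exI[of _ "Complex (ln r) (\<theta> - m)"]) auto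
      qed
      obtain a where a: "Re a \<ge> max X Y" "\<bar>Im a\<bar> \<le> w" "z1 = cis m * exp a"
        using log[OF z12(1,3)] by blast
      obtain b where b: "Re b \<ge> max X Y" "\<bar>Im b\<bar> \<le> w" "z2 = cis m * exp b"
        using log[OF z12(2,4)] by blast
      obtain z0 where z0: "f z0 \<noteq> 0" using nz by blast
      have "f (cis m * exp a) = 0" "f (cis m * exp b) = 0"
        using z12(1,2) unfolding a(3) b(3) Z_def by blast+
      then have "a = b"
        using at_most_one_zero_half_strip[OF f ode[rule_format] z0 cis_neq_zero w_pi small a(1,2) _ b(1,2)]
        by blast
      then show ?thesis using a b by simp
    qed
    have "finite (Z - cball 0 R)"
    proof (cases "Z - cball 0 R = {}")
      case False
      then obtain z1 where "z1 \<in> Z - cball 0 R" by blast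
      then have "z1 \<in> Z" "norm z1 > R" by auto
      then have "x = z1" if "x \<in> Z - cball 0 R" for x
        using at_most_one[of x z1] that by simp
      then have "Z - cball 0 R \<subseteq> {z1}" by blast
      then show ?thesis by (rule finite_subset) simp
    next
      case True
      then show ?thesis by (simp only: finite.emptyI)
    qed
    moreover have "finite {z \<in> cball 0 R. f z = 0}"
    \<comment> \<open>The compactness argument for zeros requires a nonconstant function; a constant
      \<open>f\<close> is nonzero here and has no zeros.\<close>
    proof (cases "f constant_on UNIV")
      case True
      then have "{z \<in> cball 0 R. f z = 0} = {}" using nz by (auto simp: constant_on_def)
      then show ?thesis by (simp only: finite.emptyI)
    next
      case False
      then show ?thesis
        by (rule holomorphic_compact_finite_zeros[OF f open_UNIV connected_UNIV compact_cball subset_UNIV])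
    qed
    ultimately have "finite (Z - cball 0 R \<union> {z \<in> cball 0 R. f z = 0})" by simp
    then show ?thesis by (rule rev_finite_subset) (auto simp: Z_def)
  qed
qed

end
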